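(* Let $n\in\mathbf N_0$ satisfy the condition $$(1_0)\qquad n(z)=-\frac{s_0}{z}+\mathrm o\!\left(\frac1z\right),\qquad z=iy,\ y\to\pm\infty,$$ let an operator representation $$n(z)=\big((A-z)^{-1}u,u\big),\qquad z\in\mathbb C\setminus\mathbb R,$$ of $n$ be given, where $A$ is a self-adjoint operator in a Hilbert space $\mathcal H$ and $u\in\mathcal H$ with $(u,u)=s_0$, and let $$\widehat n(z)=\frac{-s_0}{n(z)}-z+\frac{s_1}{s_0}$$ be the Schur transform of $n$. Then in the operator representation $$\widehat n(z)=\widehat n(z_0)^*+(z-z_0^* )\left((\widehat A-z_0)(\widehat A-z)^{-1}\widehat v,\widehat v\right)\qquad(\ast)$$ of $\widehat n$, where $z_0$ is an arbitrary non-real number, we can choose $\widehat{\mathcal H}=\{u\}^\perp$, the operator $\widehat A$ in $\widehat{\mathcal H}$ as the compression of $A$ to $\widehat{\mathcal H}$, that is, $\widehat A=\widehat PA|_{\widehat{\mathcal H}}$, where $\widehat P$ is the orthogonal projection in $\mathcal H$ onto $\widehat{\mathcal H}$, and the element $\widehat v$ as $$\widehat v=\frac{\|u\|}{((A-z_0)^{-1}u,u)}\,\widehat P(A-z_0)^{-1}u.$$ If $\widehat n$ also satisfies the condition $(1_0)$, that is, $\widehat n(z)=-\frac{\widehat s_0}{z}+\mathrm o\!\left(\frac1z\right)$ for $z=iy$, $y\to\pm\infty$, with some real $\widehat s_0$ (this is the case when $n(z)=-\frac{s_0}{z}-\frac{s_1}{z^2}-\frac{s_2}{z^3}+\mathrm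 o\!\left(\frac1{z^3}\right)$ for $z=iy$, $y\to\pm\infty$), then $$\widehat n(z)=\left((\widehat A-z)^{-1}\widehat u,\widehat u\right),\qquad \widehat u:=\frac{\widehat PAu}{\|u\|}.$$
   Context: A Nevanlinna function is a function $n$ that is analytic in the open upper half plane $\mathbb C^+$ with $\operatorname{Im} n(z)\ge 0$ for $z\in\mathbb C^+$; it is always extended to the lower half plane by $n(z)=n(z^* )^*$, where $z^*$ denotes the complex conjugate. $\mathbf N_0$ denotes the set of all Nevanlinna functions. The Schur transform $\widehat n$ of $n\in\mathbf N_0$ is defined by the displayed formula when $n$ has the expansion $n(z)=-\frac{s_0}{z}-\frac{s_1}{z^2}+\mathrm o\!\left(\frac1{z^2}\right)$ for $z=iy$, $y\to\pm\infty$, with real $s_0$, $s_1$; these are the numbers $s_0,s_1$ in the formula for $\widehat n$. The Schur transform belongs to $\mathbf N_0$ and is $\mathrm o(z)$ for $z=iy$, $y\to\infty$, and therefore admits an operator representation of the form $(\ast)$ with a self-adjoint operator $\widehat A$ in some Hilbert space $\widehat{\mathcal H}$, an arbitrary non-real number $z_0$, and an element $\widehat v\in\widehat{\mathcal H}$. Operators may be unbounded; inner products are linear in the first argument. *)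

theory Defs
  imports "HOL-Analysis.Analysis" "HOL-Library.Landau_Symbols"
begin

section \<open>Complex Hilbert spaces\<close>

text \<open>
  The inner product is linear in the first argument.
\<close>

class complex_inner = real_normed_vector +
  fixes scaleC :: "complex \<Rightarrow> 'a \<Rightarrow> 'a" (infixr "*\<^sub>C" 75)
    and cinner :: "'a \<Rightarrow> 'a \<Rightarrow> complex"
  assumes scaleC_of_real: "of_real r *\<^sub>C x = r *\<^sub>R x"
    and scaleC_add_right: "c *\<^sub>C (x + y) = c *\<^sub>C x + c *\<^sub>C y"
    and scaleC_add_left: "(c + d) *\<^sub>C x = c *\<^sub>C x + d *\<^sub>C x"
    and scaleC_scaleC: "c *\<^sub>C d *\<^sub>C x = (c * d) *\<^sub>C x"
    and cinner_commute: "cinner x y = cnj (cinner y x)"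
    and cinner_add_left: "cinner (x + y) z = cinner x z + cinner y z"
    and cinner_scaleC_left: "cinner (c *\<^sub>C x) y = c * cinner x y"
    and cinner_self: "cinner x x = of_real ((norm x)\<^sup>2)"

class complex_hilbert = complex_inner + complete_space

instantiation complex :: complex_hilbert
begin

definition scaleC_complex :: "complex \<Rightarrow> complex \<Rightarrow> complex"
  where "scaleC_complex c x = c * x"

definition cinner_complex :: "complex \<Rightarrow> complex \<Rightarrow> complex"
  where "cinner_complex x y = x * cnj y"

instance
proof
  fix x :: complex
  show "cinner x x = of_real ((norm x)\<^sup>2)"
    unfolding cinner_complex_def by (rule complex_norm_square [symmetric])
qed (auto simp: scaleC_complex_def cinner_complex_def scaleR_conv_of_real algebra_simps)

end

definition csubspace :: "'h::complex_inner set \<Rightarrow> bool" where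
  "csubspace S \<longleftrightarrow> 0 \<in> S \<and> (\<forall>x\<in>S. \<forall>y\<in>S. x + y \<in> S) \<and> (\<forall>c. \<forall>x\<in>S. c *\<^sub>C x \<in> S)"

definition orth_compl :: "'h::complex_inner set \<Rightarrow> 'h set" where
  "orth_compl S = {x. \<forall>y\<in>S. cinner x y = 0}"

definition orth_proj :: "'h::complex_hilbert set \<Rightarrow> 'h \<Rightarrow> 'h" where
  "orth_proj K x = (THE p. p \<in> K \<and> x - p \<in> orth_compl K)"


section \<open>Unbounded operators\<close>

text \<open>
  An operator is a partial map, with \<^term>\<open>dom A\<close> as its domain.  Since the space
  orthogonal to a vector is not a type, an operator in a closed subspace \<open>K\<close>, itself a Hilbert
  space, is a partial map with domain and range contained in \<open>K\<close>; adjoints are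
  taken inside \<open>K\<close>.
\<close>

definition linear_operator_in :: "'h::complex_inner set \<Rightarrow> ('h \<rightharpoonup> 'h) \<Rightarrow> bool" where
  "linear_operator_in K A \<longleftrightarrow>
     dom A \<subseteq> K \<and> ran A \<subseteq> K \<and> csubspace (dom A) \<and>
     (\<forall>x\<in>dom A. \<forall>y\<in>dom A. the (A (x + y)) = the (A x) + the (A y)) \<and>
     (\<forall>c. \<forall>x\<in>dom A. the (A (c *\<^sub>C x)) = c *\<^sub>C the (A x))"

text \<open>The choice of \<open>w\<close> is unique if \<^term>\<open>dom A\<close> is dense in \<open>K\<close>.\<close>

definition adjoint_in :: "'h::complex_inner set \<Rightarrow> ('h \<rightharpoonup> 'h) \<Rightarrow> ('h \<rightharpoonup> 'h)" where
  "adjoint_in K A y =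
     (if y \<in> K \<and> (\<exists>w\<in>K. \<forall>x\<in>dom A. cinner (the (A x)) y = cinner x w)
      then Some (THE w. w \<in> K \<and> (\<forall>x\<in>dom A. cinner (the (A x)) y = cinner x w))
      else None)"

definition self_adjoint_in :: "'h::complex_inner set \<Rightarrow> ('h \<rightharpoonup> 'h) \<Rightarrow> bool" where
  "self_adjoint_in K A \<longleftrightarrow>
     csubspace K \<and> closed K \<and> linear_operator_in K A \<and> K \<subseteq> closure (dom A) \<and>
     adjoint_in K A = A"

definition op_shift :: "('h::complex_inner \<rightharpoonup> 'h) \<Rightarrow> complex \<Rightarrow> ('h \<rightharpoonup> 'h)" where
  "op_shift A z x = map_option (\<lambda>y. y - z *\<^sub>C x) (A x)"

definition op_inverse :: "('h \<rightharpoonup> 'h) \<Rightarrow> ('h \<rightharpoonup> 'h)" where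
  "op_inverse B y = (if \<exists>!x. B x = Some y then Some (THE x. B x = Some y) else None)"

definition resolvent :: "('h::complex_inner \<rightharpoonup> 'h) \<Rightarrow> complex \<Rightarrow> ('h \<rightharpoonup> 'h)" where
  "resolvent A z = op_inverse (op_shift A z)"

definition compression :: "'h::complex_hilbert set \<Rightarrow> ('h \<rightharpoonup> 'h) \<Rightarrow> ('h \<rightharpoonup> 'h)" where
  "compression K A x = (if x \<in> K then map_option (orth_proj K) (A x) else None)"


section \<open>Nevanlinna functions\<close>

definition Nevanlinna :: "(complex \<Rightarrow> complex) set" where
  "Nevanlinna = {n. n holomorphic_on {z. Im z > 0} \<and> (\<forall>z. Im z > 0 \<longrightarrow> Im (n z) \<ge> 0) \<and>
     (\<forall>z. Im z < 0 \<longrightarrow> n z = cnj (n (cnj z)))}"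

text \<open>
  The filter of \<open>z = i y\<close> with \<open>y\<close> tending to plus or minus infinity:
  \<^term>\<open>at_infinity\<close> on the reals is the supremum of \<^term>\<open>at_top\<close> and \<^term>\<open>at_bot\<close>.
\<close>

definition imag_infinity :: "complex filter" where
  "imag_infinity = filtermap (\<lambda>y::real. \<i> * of_real y) at_infinity"

definition Schur_transform :: "real \<Rightarrow> real \<Rightarrow> (complex \<Rightarrow> complex) \<Rightarrow> complex \<Rightarrow> complex" where
  "Schur_transform s0 s1 n z = - of_real s0 / n z - z + of_real s1 / of_real s0"

end

theory Submission
  imports Defs
begin

text \<open>
  The compression problem \<open>P (A - z) x = f\<close> with \<open>x \<bottom> u\<close> means \<open>(A - z) x = f + c u\<close> for some scalar
  \<open>c\<close>, and orthogonality fixes \<open>c\<close>: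
  \<open>x = R z f - ((R z f, u) / (R z u, u)) R z u\<close> with \<open>R z = (A - z)\<inverse>\<close>.  So the compression is symmetric,
  densely defined and all its shifts by non-real numbers are onto, which makes it self-adjoint.
  The vectors \<open>\<gamma> z = R z u / n z - u / s0\<close> satisfy
  \<open>(Ahat - w) (Ahat - z)\<inverse> \<gamma> w = \<gamma> z\<close>, and the representation of the Schur transform reduces to
  the identity \<open>(z - w\<^sup>*) (R z u, R w u) = n z - (n w)\<^sup>*\<close>.

  On the imaginary axis \<open>\<parallel>A (R z u)\<parallel>\<^sup>2 = Re (s0 + z n z)\<close>.  If the Schur transform is
  \<open>- shat0 / z + o(1 / z)\<close>, this is \<open>O(1 / \<bar>z\<bar>\<^sup>2)\<close>, so \<open>w \<mapsto> (A w, u)\<close> is a bounded functional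
  and \<open>u\<close> lies in the domain of \<open>A\<close>; comparing expansions gives \<open>s1 = (A u, u)\<close>, and the
  second formula is the Schur complement of \<open>A - z\<close> with respect to \<open>u\<close>.
\<close>

section \<open>Complex inner products\<close>

text \<open>Makes the scalar laws of \<open>vector_space\<close> available for
  \<open>scaleC\<close>; the unit law is \<open>scaleC_of_real\<close> at 1.\<close>

global_interpretation complex_inner: vector_space "scaleC :: complex \<Rightarrow> 'a \<Rightarrow> 'a::complex_inner"
  by unfold_locales (simp_all add: scaleC_add_right scaleC_add_left scaleC_scaleC
      scaleC_of_real [of 1, simplified])

lemma scaleC_minus1: "(-1) *\<^sub>C x = - (x::'a::complex_inner)"
  by simp

lemma cinner_add_right: "cinner x (y + z) = cinner x y + cinner x (z::'a::complex_inner)"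
  by (metis cinner_add_left cinner_commute complex_cnj_add)

lemma cinner_scaleC_right: "cinner x (c *\<^sub>C y) = cnj c * cinner x (y::'a::complex_inner)"
  by (metis cinner_scaleC_left cinner_commute complex_cnj_mult)

lemma cinner_minus_left: "cinner (- x) y = - cinner x (y::'a::complex_inner)"
  by (metis scaleC_minus1 cinner_scaleC_left mult_minus1)

lemma cinner_minus_right: "cinner x (- y) = - cinner x (y::'a::complex_inner)"
  by (metis cinner_minus_left cinner_commute complex_cnj_minus)

lemma cinner_diff_left: "cinner (x - y) z = cinner x z - cinner y (z::'a::complex_inner)"
  by (metis cinner_add_left cinner_minus_left diff_conv_add_uminus)

lemma cinner_diff_right: "cinner x (y - z) = cinner x y - cinner x (z::'a::complex_inner)"
  by (metis cinner_add_right cinner_minus_right diff_conv_add_uminus)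

lemma cinner_zero_left [simp]: "cinner 0 (x::'a::complex_inner) = 0"
  using cinner_diff_left [of 0 0 x] by simp

lemma cinner_zero_right [simp]: "cinner (x::'a::complex_inner) 0 = 0"
  using cinner_diff_right [of x 0 0] by simp

lemmas cinner_simps = cinner_add_left cinner_add_right cinner_diff_left cinner_diff_right
  cinner_scaleC_left cinner_scaleC_right cinner_minus_left cinner_minus_right

lemmas scaleC_algebra = complex_inner.scale_right_diff_distrib complex_inner.scale_left_diff_distrib
  complex_inner.scale_right_distrib complex_inner.scale_left_distrib

lemma cinner_eq_zero_iff: "cinner x x = 0 \<longleftrightarrow> (x::'a::complex_inner) = 0"
  by (simp add: cinner_self)

lemma norm_scaleC: "norm (c *\<^sub>C x) = cmod c * norm (x::'a::complex_inner)"
proof -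
  have "complex_of_real ((norm (c *\<^sub>C x))\<^sup>2) = of_real ((cmod c * norm x)\<^sup>2)"
    unfolding cinner_self [symmetric] cinner_simps
    by (simp add: cinner_self power_mult_distrib mult.commute [of "cnj c"] mult.assoc [symmetric]
        complex_norm_square [symmetric])
  then show ?thesis
    by (simp only: of_real_eq_iff) simp
qed

section \<open>Norm identities, the Cauchy-Schwarz inequality and continuity of the inner
  product\<close>

lemma norm_diff_sq: "(norm (x - y))\<^sup>2 = (norm x)\<^sup>2 - 2 * Re (cinner x y) + (norm (y::'a::complex_inner))\<^sup>2"
proof -
  have "complex_of_real ((norm (x - y))\<^sup>2) = of_real ((norm x)\<^sup>2) - cinner x y - cnj (cinner x y) + of_real ((norm y)\<^sup>2)"
    unfolding cinner_self [symmetric] cinner_simps by (simp add: cinner_commute [of y x])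
  from arg_cong [OF this, of Re] show ?thesis
    by simp
qed

lemma norm_add_sq: "(norm (x + y))\<^sup>2 = (norm x)\<^sup>2 + 2 * Re (cinner x y) + (norm (y::'a::complex_inner))\<^sup>2"
  using norm_diff_sq [of x "- y"] by (simp add: cinner_simps)

lemma cinner_Cauchy_Schwarz: "cmod (cinner x y) \<le> norm x * norm (y::'a::complex_inner)"
proof (cases "y = 0")
  case False
  \<comment> \<open>\<open>c *\<^sub>C y\<close> is the orthogonal projection of \<open>x\<close>
    onto the line through \<open>y\<close>.\<close>
  define c where "c = cinner x y / cinner y y"
  have *: "cinner x (c *\<^sub>C y) = of_real ((cmod (cinner x y))\<^sup>2 / (norm y)\<^sup>2)"
    by (simp add: c_def cinner_simps cinner_self mult.commute [of "cnj _"] complex_norm_square [symmetric])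
  have **: "(norm (c *\<^sub>C y))\<^sup>2 = (cmod (cinner x y))\<^sup>2 / (norm y)\<^sup>2"
    by (simp add: c_def norm_scaleC cinner_self norm_divide norm_power norm_mult power2_eq_square field_simps)
  have "0 \<le> (norm (x - c *\<^sub>C y))\<^sup>2" by simp
  also have "\<dots> = (norm x)\<^sup>2 - (cmod (cinner x y))\<^sup>2 / (norm y)\<^sup>2"
    unfolding norm_diff_sq * ** by simp
  finally have "(cmod (cinner x y))\<^sup>2 \<le> (norm x * norm y)\<^sup>2"
    using False by (simp add: field_simps)
  then show ?thesis
    by (rule power2_le_imp_le) simp
qed simp

lemma bounded_linear_cinner_left: "bounded_linear (\<lambda>x. cinner x (y::'a::complex_inner))"
  by (rule bounded_linear_intro [where K = "norm y"])
     (simp_all add: cinner_simps cinner_Cauchy_Schwarz scaleC_of_real [symmetric, where 'a = 'a]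
       scaleR_conv_of_real)

lemma bounded_linear_cinner_right: "bounded_linear (\<lambda>y. cinner (x::'a::complex_inner) y)"
  by (rule bounded_linear_intro [where K = "norm x"])
     (simp_all add: cinner_simps cinner_Cauchy_Schwarz scaleC_of_real [symmetric, where 'a = 'a]
       scaleR_conv_of_real mult.commute [of _ "norm x"])

lemma bounded_linear_scaleC: "bounded_linear (\<lambda>x. c *\<^sub>C (x::'a::complex_inner))"
  by (rule bounded_linear_intro [where K = "cmod c"])
     (simp_all add: scaleC_algebra norm_scaleC scaleC_of_real [symmetric] mult.commute)

text \<open>A sequence in \<open>S\<close> converging to \<open>d\<close> gives
  \<open>cinner d d = 0\<close> by continuity. With \<open>S\<close> a dense domain, this makes
  adjoints single-valued.\<close>

lemma eq_zero_if_orth_closure: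
  fixes d :: "'a::complex_inner"
  assumes "d \<in> closure S" and "\<And>x. x \<in> S \<Longrightarrow> cinner x d = 0"
  shows "d = 0"
proof -
  obtain f where f: "\<And>n. f n \<in> S" "f \<longlonglongrightarrow> d"
    using assms(1) unfolding closure_sequential by blast
  have "(\<lambda>n. cinner (f n) d) \<longlonglongrightarrow> cinner d d"
    using bounded_linear.tendsto [OF bounded_linear_cinner_left f(2)] .
  then have "cinner d d = 0"
    using f(1) assms(2) LIMSEQ_unique [OF _ tendsto_const] by simp
  then show ?thesis
    by (simp add: cinner_eq_zero_iff)
qed

text \<open>The representing vector is the limit of any minimising sequence of
  \<open>\<parallel>x\<parallel>\<^sup>2 - 2 Re (f x)\<close>; the parallelogram law makes such a sequence Cauchy.\<close>

lemma Riesz_representation: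
  fixes S :: "'a::complex_hilbert set" and f :: "'a \<Rightarrow> complex"
  assumes S: "csubspace S"
    and add: "\<And>x y. x \<in> S \<Longrightarrow> y \<in> S \<Longrightarrow> f (x + y) = f x + f y"
    and scale: "\<And>c x. x \<in> S \<Longrightarrow> f (c *\<^sub>C x) = c * f x"
    and bound: "\<And>x. x \<in> S \<Longrightarrow> cmod (f x) \<le> C * norm x"
  obtains g where "g \<in> closure S" "\<And>x. x \<in> S \<Longrightarrow> f x = cinner x g"
proof -
  define J where "J x = (norm x)\<^sup>2 - 2 * Re (f x)" for x
  have ne: "S \<noteq> {}" using S by (auto simp: csubspace_def)
  \<comment> \<open>Completing the square: \<open>J x\<close> is at least
    \<open>(norm x - C)\<^sup>2 - C\<^sup>2\<close>.\<close>
  have bd: "- (C\<^sup>2) \<le> J x" if "x \<in> S" for x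
  proof -
    have "Re (f x) \<le> C * norm x"
      using bound [OF that] abs_Re_le_cmod [of "f x"] by linarith
    moreover have "0 \<le> (norm x - C)\<^sup>2" by simp
    ultimately show ?thesis
      by (simp add: J_def power2_diff algebra_simps)
  qed
  then have bb: "bdd_below (J ` S)" by (auto intro!: bdd_belowI2)
  define m where "m = Inf (J ` S)"
  have mle: "m \<le> J x" if "x \<in> S" for x
    unfolding m_def using bb that by (rule cINF_lower)
  have ex: "\<exists>x\<in>S. J x < m + inverse (real (Suc k))" for k
    using cINF_less_iff [OF ne bb, of "m + inverse (real (Suc k))"] unfolding m_def [symmetric]
    by simp
  then obtain X where X: "\<And>k. X k \<in> S" "\<And>k. J (X k) < m + inverse (real (Suc k))"
    by metis
  \<comment> \<open>Parallelogram law, with \<open>m\<close> bounding \<open>J\<close> from below at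
    the midpoint of \<open>x\<close> and \<open>y\<close>.\<close>
  have mid: "(norm (x - y))\<^sup>2 + 4 * m \<le> 2 * J x + 2 * J y" if "x \<in> S" "y \<in> S" for x y
  proof -
    have xy: "x + y \<in> S" and h: "(1/2) *\<^sub>C (x + y) \<in> S"
      using S that by (simp_all add: csubspace_def)
    have "4 * m \<le> 4 * J ((1/2) *\<^sub>C (x + y))"
      using mle [OF h] by simp
    also have "\<dots> = (norm (x + y))\<^sup>2 - 4 * Re (f x) - 4 * Re (f y)"
      using that xy by (simp add: J_def norm_scaleC scale add power_mult_distrib power2_eq_square
          add_divide_distrib
          del: complex_inner.scale_right_distrib)
    finally show ?thesis
      unfolding J_def norm_diff_sq norm_add_sq by simp
  qed
  have "Cauchy X"
  proof (rule metric_CauchyI)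
    fix e :: real assume "0 < e"
    then obtain N where N: "inverse (real (Suc N)) < e\<^sup>2 / 4"
      using reals_Archimedean [of "e\<^sup>2 / 4"] by auto
    have J: "4 * J (X k) < 4 * m + e\<^sup>2" if "N \<le> k" for k
    proof -
      have "inverse (real (Suc k)) \<le> inverse (real (Suc N))"
        using that by (intro le_imp_inverse_le) auto
      then show ?thesis using X(2) [of k] N by linarith
    qed
    have "dist (X k) (X l) < e" if "N \<le> k" "N \<le> l" for k l
    proof -
      have "(norm (X k - X l))\<^sup>2 < e\<^sup>2"
        using mid [OF X(1) X(1), of k l] J [OF that(1)] J [OF that(2)] by linarith
      from power2_less_imp_less [OF this] \<open>0 < e\<close> show ?thesis
        by (simp add: dist_norm)
    qed
    then show "\<exists>M. \<forall>m\<ge>M. \<forall>n\<ge>M. dist (X m) (X n) < e" by blast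
  qed
  then obtain g where g: "X \<longlonglongrightarrow> g"
    by (auto simp: Cauchy_convergent_iff convergent_def)
  have gc: "g \<in> closure S"
    using g X(1) closure_sequential by blast
  have J0: "(\<lambda>k. J (X k)) \<longlonglongrightarrow> m"
  proof (rule tendsto_sandwich [where f = "\<lambda>_. m" and h = "\<lambda>k. m + inverse (real (Suc k))"])
    show "(\<lambda>k. m + inverse (real (Suc k))) \<longlonglongrightarrow> m"
      using tendsto_add [OF tendsto_const [of m] LIMSEQ_inverse_real_of_nat] by simp
  qed (use X mle in \<open>auto intro!: eventuallyI simp: less_imp_le simp del: of_nat_Suc\<close>)
  \<comment> \<open>Compare \<open>J\<close> at \<open>x + X k\<close> with its infimum
    \<open>m\<close> and let \<open>k\<close> tend to infinity; \<open>J (X k)\<close> cancels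
    against \<open>m\<close> in the limit.\<close>
  have key: "0 \<le> 2 * Re (cinner x g - f x) + (norm x)\<^sup>2" if "x \<in> S" for x
  proof (rule LIMSEQ_le_const)
    have "(\<lambda>k. J (X k) + (2 * Re (cinner x (X k) - f x) + (norm x)\<^sup>2) - m)
        \<longlonglongrightarrow> m + (2 * Re (cinner x g - f x) + (norm x)\<^sup>2) - m"
      by (intro tendsto_intros J0 bounded_linear.tendsto [OF bounded_linear_cinner_right g])
    then show "(\<lambda>k. J (X k) + (2 * Re (cinner x (X k) - f x) + (norm x)\<^sup>2) - m)
        \<longlonglongrightarrow> 2 * Re (cinner x g - f x) + (norm x)\<^sup>2"
      by simp
    have "0 \<le> J (X k) + (2 * Re (cinner x (X k) - f x) + (norm x)\<^sup>2) - m" for k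
    proof -
      have "x + X k \<in> S" using S that X(1) by (simp add: csubspace_def)
      from mle [OF this] show ?thesis
        using add [OF that X(1), of k] unfolding J_def norm_add_sq by simp
    qed
    then show "\<exists>N. \<forall>n\<ge>N. 0 \<le> J (X n) + (2 * Re (cinner x (X n) - f x) + (norm x)\<^sup>2) - m"
      by blast
  qed
  have "f x = cinner x g" if "x \<in> S" for x
  proof (rule ccontr)
    define d where "d = cinner x g - f x"
    assume "f x \<noteq> cinner x g"
    then have d: "d \<noteq> 0" by (simp add: d_def)
    \<comment> \<open>With this \<open>t\<close> and the \<open>c\<close> below, the linear term
      \<open>-2 * t * (cmod d)\<^sup>2\<close> outweighs the quadratic one, since
      \<open>t * (norm x)\<^sup>2 < 1\<close>.\<close>
    define t where "t = 1 / (1 + (norm x)\<^sup>2)"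
    have p: "0 < 1 + (norm x)\<^sup>2" by (simp add: add_pos_nonneg)
    then have t: "0 < t" by (simp add: t_def)
    define c where "c = - (of_real t * cnj d)"
    have "0 \<le> 2 * Re (cinner (c *\<^sub>C x) g - f (c *\<^sub>C x)) + (norm (c *\<^sub>C x))\<^sup>2"
      using S that by (intro key) (simp add: csubspace_def)
    also have "cinner (c *\<^sub>C x) g - f (c *\<^sub>C x) = - (of_real t * (d * cnj d))"
      using that scale [of x c]
      by (simp add: c_def d_def cinner_simps algebra_simps)
    also have "(norm (c *\<^sub>C x))\<^sup>2 = (cmod d)\<^sup>2 * (t * (t * (norm x)\<^sup>2))"
      by (simp add: c_def norm_scaleC norm_mult power_mult_distrib power2_eq_square)
    also have "Re (- (of_real t * (d * cnj d))) = - (t * (cmod d)\<^sup>2)"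
      unfolding complex_norm_square [symmetric] by simp
    finally have "(cmod d)\<^sup>2 * t * 2 \<le> (cmod d)\<^sup>2 * t * (t * (norm x)\<^sup>2)"
      by (simp add: algebra_simps)
    then have "2 \<le> t * (norm x)\<^sup>2"
      using d t by simp
    then show False
      using p by (simp add: t_def field_simps)
  qed
  with gc show ?thesis by (rule that)
qed

section \<open>Symmetric and self-adjoint operators\<close>

lemma csubspace_orth_compl: "csubspace (orth_compl (S::'a::complex_inner set))"
  by (auto simp: csubspace_def orth_compl_def cinner_simps)

lemma closed_orth_compl: "closed (orth_compl (S::'a::complex_inner set))"
proof -
  have "orth_compl S = (\<Inter>y\<in>S. {x. cinner x y = 0})"
    by (auto simp: orth_compl_def)
  moreover have "closed {x. cinner x y = 0}" for y :: 'a
    by (intro closed_Collect_eq continuous_on_const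
        linear_continuous_on bounded_linear_cinner_left)
  ultimately show ?thesis by auto
qed

lemma csubspace_diff: "csubspace S \<Longrightarrow> x \<in> S \<Longrightarrow> y \<in> S \<Longrightarrow> x - y \<in> (S::'a::complex_inner set)"
  unfolding csubspace_def by (metis diff_conv_add_uminus scaleC_minus1)

text \<open>Two candidates differ by a vector that lies both in \<open>K\<close> and in its
  orthogonal complement, hence is zero.\<close>

lemma orth_proj_eqI:
  assumes K: "csubspace K" and p: "p \<in> K" "x - p \<in> orth_compl K"
  shows "orth_proj K x = p"
  unfolding orth_proj_def
proof (rule the_equality)
  fix q assume q: "q \<in> K \<and> x - q \<in> orth_compl K"
  have "p - q \<in> K" using csubspace_diff K p q by blast
  moreover have "(x - q) - (x - p) \<in> orth_compl K"
    using csubspace_diff csubspace_orth_compl p q by blast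
  ultimately have "cinner (p - q) (p - q) = 0"
    by (simp add: orth_compl_def)
  then show "q = p" by (simp add: cinner_eq_zero_iff)
qed (use p in simp)

lemma orth_proj_orth_compl_singleton:
  assumes "u \<noteq> 0"
  shows "orth_proj (orth_compl {u}) x = x - (cinner x u / cinner u u) *\<^sub>C u"
proof (rule orth_proj_eqI [OF csubspace_orth_compl])
  show "x - (cinner x u / cinner u u) *\<^sub>C u \<in> orth_compl {u}"
    using assms by (simp add: orth_compl_def cinner_simps cinner_eq_zero_iff)
  have "cinner u y = 0" if "cinner y u = 0" for y
    using that cinner_commute [of u y] by simp
  then show "x - (x - (cinner x u / cinner u u) *\<^sub>C u) \<in> orth_compl (orth_compl {u})"
    by (simp add: orth_compl_def cinner_simps)
qed

section \<open>Linear operators as partial maps, symmetry and adjoints\<close>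

lemma linear_operator_in_add:
  assumes "linear_operator_in K A" "A x = Some x'" "A y = Some y'"
  shows "A (x + y) = Some (x' + y')"
proof -
  have "x \<in> dom A" "y \<in> dom A" using assms by auto
  then have "x + y \<in> dom A" "the (A (x + y)) = x' + y'"
    using assms by (auto simp: linear_operator_in_def csubspace_def)
  then show ?thesis by force
qed

lemma linear_operator_in_scaleC:
  assumes "linear_operator_in K A" "A x = Some x'"
  shows "A (c *\<^sub>C x) = Some (c *\<^sub>C x')"
proof -
  have "x \<in> dom A" using assms by auto
  then have "c *\<^sub>C x \<in> dom A" "the (A (c *\<^sub>C x)) = c *\<^sub>C x'"
    using assms by (auto simp: linear_operator_in_def csubspace_def)
  then show ?thesis by force
qed

lemma linear_operator_in_diff:
  assumes "linear_operator_in K A" "A x = Some x'" "A y = Some y'"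
  shows "A (x - y) = Some (x' - y')"
  using linear_operator_in_add [OF assms(1,2) linear_operator_in_scaleC [OF assms(1,3), of "-1"]]
  by simp

definition symmetric_op :: "('h::complex_inner \<rightharpoonup> 'h) \<Rightarrow> bool" where
  "symmetric_op A \<longleftrightarrow>
     (\<forall>x y x' y'. A x = Some x' \<longrightarrow> A y = Some y' \<longrightarrow> cinner x' y = cinner x y')"

lemma symmetric_opD:
  "symmetric_op A \<Longrightarrow> A x = Some x' \<Longrightarrow> A y = Some y' \<Longrightarrow> cinner x' y = cinner x y'"
  by (auto simp: symmetric_op_def)

text \<open>Density of the domain makes the representing vector unique, so the \<open>THE\<close> in
  \<open>adjoint_in\<close> can be replaced by any witness.\<close>

lemma adjoint_in_eq_Some_iff:
  assumes K: "csubspace K" "K \<subseteq> closure (dom A)"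
  shows "adjoint_in K A y = Some w \<longleftrightarrow>
    y \<in> K \<and> w \<in> K \<and> (\<forall>x x'. A x = Some x' \<longrightarrow> cinner x' y = cinner x w)" (is "_ = ?R")
proof -
  let ?Q = "\<lambda>w. w \<in> K \<and> (\<forall>x\<in>dom A. cinner (the (A x)) y = cinner x w)"
  have Q: "?Q w \<longleftrightarrow> w \<in> K \<and> (\<forall>x x'. A x = Some x' \<longrightarrow> cinner x' y = cinner x w)" for w
    by (simp add: Ball_def domIff) (metis option.collapse option.sel option.distinct(1))
  have uniq: "v = w" if "?Q v" "?Q w" for v w
  proof -
    have "v - w = 0"
    proof (rule eq_zero_if_orth_closure)
      show "v - w \<in> closure (dom A)" using that K csubspace_diff by blast
    qed (use that in \<open>auto simp: cinner_simps\<close>)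
    then show ?thesis by simp
  qed
  have the: "(THE w. ?Q w) = w" if "?Q w" for w
    using that uniq by (intro the_equality) blast+
  show ?thesis
  proof
    assume *: "adjoint_in K A y = Some w"
    then have y: "y \<in> K" and ex: "\<exists>w. ?Q w" and w: "w = (THE w. ?Q w)"
      unfolding adjoint_in_def by (auto split: if_splits)
    from ex obtain v where "?Q v" by blast
    with w the have "?Q w" by metis
    with y Q show ?R by blast
  next
    assume ?R
    with Q have "y \<in> K" "?Q w" by blast+
    moreover from this(2) have "(THE w. ?Q w) = w" by (rule the)
    ultimately show "adjoint_in K A y = Some w"
      unfolding adjoint_in_def by auto
  qed
qed

lemma self_adjoint_in_imp_symmetric:
  assumes "self_adjoint_in K A"
  shows "symmetric_op A"
  unfolding symmetric_op_def
proof (intro allI impI)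
  fix x y x' y' assume *: "A x = Some x'" "A y = Some y'"
  from assms have K: "csubspace K" "K \<subseteq> closure (dom A)" and "adjoint_in K A = A"
    by (auto simp: self_adjoint_in_def)
  then have "adjoint_in K A y = Some y'" using * by simp
  with * show "cinner x' y = cinner x y'"
    unfolding adjoint_in_eq_Some_iff [OF K] by blast
qed

text \<open>This is the inclusion of the adjoint in \<open>A\<close>. It serves to place limits,
  Riesz vectors and eigenvectors in the domain of \<open>A\<close>.\<close>

lemma self_adjoint_in_maximal:
  assumes "self_adjoint_in K A" "y \<in> K" "w \<in> K"
    and "\<And>x x'. A x = Some x' \<Longrightarrow> cinner x' y = cinner x w"
  shows "A y = Some w"
proof -
  from assms(1) have K: "csubspace K" "K \<subseteq> closure (dom A)" and "adjoint_in K A = A"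
    by (auto simp: self_adjoint_in_def)
  moreover have "adjoint_in K A y = Some w"
    using assms unfolding adjoint_in_eq_Some_iff [OF K] by blast
  ultimately show ?thesis by simp
qed

text \<open>If the adjoint takes \<open>y\<close> to \<open>w\<close>, surjectivity of
  \<open>B - cnj z\<close> gives \<open>x0\<close> in the domain of \<open>B\<close> with
  \<open>(B - cnj z) x0 = w - cnj z y\<close>. Then \<open>y - x0\<close> is orthogonal to the range
  of \<open>B - z\<close>, which is all of \<open>K\<close>.\<close>

lemma self_adjoint_inI_range:
  assumes K: "csubspace K" "closed K" and lin: "linear_operator_in K B"
    and dense: "K \<subseteq> closure (dom B)" and sym: "symmetric_op B"
    and ran: "\<And>f. f \<in> K \<Longrightarrow> \<exists>x. B x = Some (f + z *\<^sub>C x)"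
      "\<And>f. f \<in> K \<Longrightarrow> \<exists>x. B x = Some (f + cnj z *\<^sub>C x)"
  shows "self_adjoint_in K B"
proof -
  have memK: "x \<in> K" "x' \<in> K" if "B x = Some x'" for x x'
    using lin that unfolding linear_operator_in_def by (auto intro: ranI)
  have "adjoint_in K B y = Some w \<longleftrightarrow> B y = Some w" for y w
  proof
    assume "B y = Some w"
    then show "adjoint_in K B y = Some w"
      unfolding adjoint_in_eq_Some_iff [OF K(1) dense]
      using memK symmetric_opD [OF sym] by blast
  next
    assume "adjoint_in K B y = Some w"
    then have y: "y \<in> K" "w \<in> K" and adj: "\<And>x x'. B x = Some x' \<Longrightarrow> cinner x' y = cinner x w"
      unfolding adjoint_in_eq_Some_iff [OF K(1) dense] by blast+
    have "w - cnj z *\<^sub>C y \<in> K"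
      using y K(1) by (intro csubspace_diff) (auto simp: csubspace_def)
    then obtain x0 where x0: "B x0 = Some (w - cnj z *\<^sub>C y + cnj z *\<^sub>C x0)"
      using ran(2) by blast
    have "y - x0 \<in> K"
      using y memK [OF x0] K(1) csubspace_diff by blast
    \<comment> \<open>For this \<open>x\<close> the adjoint relation and the symmetry of
      \<open>B\<close> show that \<open>y\<close> and \<open>x0\<close> have the same inner product
      with \<open>y - x0\<close>.\<close>
    then obtain x where x: "B x = Some (y - x0 + z *\<^sub>C x)"
      using ran(1) by blast
    have "cinner (y - x0) y = cinner x w - z * cinner x y"
      using adj [OF x] by (simp add: cinner_simps eq_diff_eq)
    moreover have "cinner (y - x0) x0 = cinner x w - z * cinner x y"
      using symmetric_opD [OF sym x x0] by (simp add: cinner_simps)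
    ultimately have "cinner (y - x0) (y - x0) = 0"
      by (simp only: cinner_diff_right) simp
    then have "y = x0" by (simp add: cinner_eq_zero_iff)
    with x0 show "B y = Some w" by simp
  qed
  then have "adjoint_in K B = B"
    by (intro ext) (metis not_None_eq)
  with K lin dense show ?thesis by (simp add: self_adjoint_in_def)
qed

section \<open>The range of \<open>A - z\<close> and the resolvent for non-real
  \<open>z\<close>\<close>

lemma symmetric_op_inner_real:
  assumes "symmetric_op A" "A x = Some x'"
  shows "cinner x' x \<in> \<real>"
  using symmetric_opD [OF assms(1) assms(2) assms(2)] cinner_commute [of x x']
  by (simp add: Reals_cnj_iff)

text \<open>The hypothesis encodes \<open>(A - z) x = f\<close> together with membership of
  \<open>x\<close> in the domain. As \<open>cinner (A x) x\<close> is real, the imaginary part of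
  \<open>cinner f x\<close> is \<open>- Im z * (norm x)\<^sup>2\<close>, and Cauchy-Schwarz bounds
  it.\<close>

lemma symmetric_op_bounded_below:
  assumes sym: "symmetric_op A" and x: "A x = Some (f + z *\<^sub>C x)"
  shows "\<bar>Im z\<bar> * norm x \<le> norm f"
proof -
  have "Im (cinner f x) = - Im z * (norm x)\<^sup>2"
  proof -
    have "Im (cinner (f + z *\<^sub>C x) x) = 0"
      using symmetric_op_inner_real [OF sym x] by (simp add: complex_is_Real_iff)
    then show ?thesis
      by (simp add: cinner_simps cinner_self flip: of_real_power)
  qed
  then have "\<bar>Im z\<bar> * (norm x)\<^sup>2 = \<bar>Im (cinner f x)\<bar>" by (simp add: abs_mult)
  also have "\<dots> \<le> norm f * norm x"
    using abs_Im_le_cmod cinner_Cauchy_Schwarz order_trans by blast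
  finally show ?thesis
    by (cases "x = 0") (simp_all add: power2_eq_square)
qed

text \<open>The lower bound with right-hand side 0 makes \<open>A - z\<close> injective, so a
  solution \<open>x\<close> is the one that \<open>op_inverse\<close> picks.\<close>

lemma resolvent_eq_SomeI:
  assumes lin: "linear_operator_in K A" and sym: "symmetric_op A" and z: "z \<notin> \<real>"
    and x: "A x = Some (f + z *\<^sub>C x)"
  shows "resolvent A z f = Some x"
proof -
  have eq: "op_shift A z y = Some f \<longleftrightarrow> A y = Some (f + z *\<^sub>C y)" for y
    by (auto simp: op_shift_def algebra_simps)
  have uniq: "y = x" if y: "A y = Some (f + z *\<^sub>C y)" for y
  proof -
    have "A (y - x) = Some (0 + z *\<^sub>C (y - x))"
      using linear_operator_in_diff [OF lin y x] by (simp add: scaleC_algebra)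
    from symmetric_op_bounded_below [OF sym this] z show ?thesis
      by (simp add: complex_is_Real_iff mult_le_0_iff)
  qed
  then have "\<exists>!y. op_shift A z y = Some f"
    unfolding eq using x by blast
  moreover have "(THE y. op_shift A z y = Some f) = x"
    unfolding eq using x uniq by (rule the_equality)
  ultimately show ?thesis
    by (simp add: resolvent_def op_inverse_def)
qed

text \<open>The lower bound turns convergence of the images into convergence of the preimages, and
  maximality puts the limit pair into the graph of \<open>A\<close>.\<close>

lemma self_adjoint_range_closed:
  fixes A :: "'h::complex_hilbert \<rightharpoonup> 'h"
  assumes sa: "self_adjoint_in UNIV A" and z: "z \<notin> \<real>"
  shows "closed {f. \<exists>x. A x = Some (f + z *\<^sub>C x)}" (is "closed ?S")
  unfolding closed_sequential_limits
proof safe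
  fix F f assume F: "\<forall>n. F n \<in> ?S" and lim: "F \<longlonglongrightarrow> f"
  have sym: "symmetric_op A" and lin: "linear_operator_in UNIV A"
    using sa self_adjoint_in_imp_symmetric by (auto simp: self_adjoint_in_def)
  have z: "0 < \<bar>Im z\<bar>" using z by (simp add: complex_is_Real_iff)
  from F obtain X where X: "\<And>n. A (X n) = Some (F n + z *\<^sub>C X n)"
    by (simp add: choice_iff) blast
  have "Cauchy X"
  proof (rule metric_CauchyI)
    fix e :: real assume "0 < e"
    then obtain N where N: "\<And>m n. m \<ge> N \<Longrightarrow> n \<ge> N \<Longrightarrow> dist (F m) (F n) < \<bar>Im z\<bar> * e"
      using metric_CauchyD [OF LIMSEQ_imp_Cauchy [OF lim], of "\<bar>Im z\<bar> * e"] z by auto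
    have "dist (X m) (X n) < e" if "m \<ge> N" "n \<ge> N" for m n
    proof -
      have "A (X m - X n) = Some ((F m - F n) + z *\<^sub>C (X m - X n))"
        using linear_operator_in_diff [OF lin X X, of m n] by (simp add: scaleC_algebra algebra_simps)
      then have "\<bar>Im z\<bar> * dist (X m) (X n) \<le> dist (F m) (F n)"
        unfolding dist_norm by (rule symmetric_op_bounded_below [OF sym])
      also have "\<dots> < \<bar>Im z\<bar> * e" using N that by blast
      finally show ?thesis using z by simp
    qed
    then show "\<exists>M. \<forall>m\<ge>M. \<forall>n\<ge>M. dist (X m) (X n) < e" by blast
  qed
  then obtain x where x: "X \<longlonglongrightarrow> x"
    by (auto simp: Cauchy_convergent_iff convergent_def)
  have "A x = Some (f + z *\<^sub>C x)"
  proof (rule self_adjoint_in_maximal [OF sa])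
    fix y y' assume y: "A y = Some y'"
    have "(\<lambda>n. cinner y (F n + z *\<^sub>C X n)) \<longlonglongrightarrow> cinner y (f + z *\<^sub>C x)"
      by (intro bounded_linear.tendsto [OF bounded_linear_cinner_right]
          tendsto_add lim bounded_linear.tendsto [OF bounded_linear_scaleC] x)
    moreover have "(\<lambda>n. cinner y' (X n)) \<longlonglongrightarrow> cinner y' x"
      by (intro bounded_linear.tendsto [OF bounded_linear_cinner_right] x)
    ultimately show "cinner y' x = cinner y (f + z *\<^sub>C x)"
      using symmetric_opD [OF sym y X] LIMSEQ_unique by simp
  qed auto
  then show "\<exists>x. A x = Some (f + z *\<^sub>C x)" by blast
qed

text \<open>A vector orthogonal to the range of \<open>A - z\<close> is an eigenvector of
  \<open>A\<close> for \<open>cnj z\<close>, hence zero. Since the range is closed, it is the whole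
  space.\<close>

lemma self_adjoint_range:
  fixes A :: "'h::complex_hilbert \<rightharpoonup> 'h"
  assumes sa: "self_adjoint_in UNIV A" and z: "z \<notin> \<real>"
  shows "\<exists>x. A x = Some (f + z *\<^sub>C x)"
proof -
  have sym: "symmetric_op A" and lin: "linear_operator_in UNIV A"
    using sa self_adjoint_in_imp_symmetric by (auto simp: self_adjoint_in_def)
  define S where "S = {f. \<exists>x. A x = Some (f + z *\<^sub>C x)}"
  have S: "csubspace S"
  proof -
    have "0 \<in> S"
    proof -
      from lin obtain x' where "A 0 = Some x'"
        by (auto simp: linear_operator_in_def csubspace_def)
      from linear_operator_in_scaleC [OF lin this, of 0] have "A 0 = Some 0" by simp
      then show ?thesis unfolding S_def by (auto intro!: exI [of _ 0])
    qed
    moreover have "f + g \<in> S" if "f \<in> S" "g \<in> S" for f g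
    proof -
      from that obtain x y where x: "A x = Some (f + z *\<^sub>C x)" and y: "A y = Some (g + z *\<^sub>C y)"
        by (auto simp: S_def)
      from linear_operator_in_add [OF lin x y] show ?thesis
        by (auto simp: S_def algebra_simps intro!: exI [of _ "x + y"])
    qed
    moreover have "c *\<^sub>C f \<in> S" if "f \<in> S" for f c
    proof -
      from that obtain x where x: "A x = Some (f + z *\<^sub>C x)"
        by (auto simp: S_def)
      from linear_operator_in_scaleC [OF lin x, of c] show ?thesis
        by (auto simp: S_def scaleC_algebra mult.commute intro!: exI [of _ "c *\<^sub>C x"])
    qed
    ultimately show ?thesis by (simp add: csubspace_def)
  qed
  \<comment> \<open>\<open>g\<close> is the orthogonal projection of \<open>f\<close> onto the
    closure of the range.\<close>
  obtain g where g: "g \<in> closure S" "\<And>s. s \<in> S \<Longrightarrow> cinner s f = cinner s g"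
    by (rule Riesz_representation [OF S, of "\<lambda>s. cinner s f" "norm f"])
       (auto simp: cinner_simps mult.commute [of "norm f"] cinner_Cauchy_Schwarz)
  have "closed S" unfolding S_def by (rule self_adjoint_range_closed [OF assms])
  with g have gS: "g \<in> S" by simp
  have "A (f - g) = Some (cnj z *\<^sub>C (f - g))"
  proof (rule self_adjoint_in_maximal [OF sa])
    fix y y' assume "A y = Some y'"
    then have "y' - z *\<^sub>C y \<in> S" by (auto simp: S_def intro!: exI [of _ y])
    from g(2) [OF this] show "cinner y' (f - g) = cinner y (cnj z *\<^sub>C (f - g))"
      by (simp add: cinner_simps algebra_simps)
  qed auto
  then have "A (f - g) = Some (0 + cnj z *\<^sub>C (f - g))" by simp
  from symmetric_op_bounded_below [OF sym this] z have "f = g"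
    by (simp add: complex_is_Real_iff mult_le_0_iff)
  with gS show ?thesis by (simp add: S_def)
qed

section \<open>Compression to the orthogonal complement of a vector\<close>

locale self_adjoint_vector =
  fixes A :: "'h::complex_hilbert \<rightharpoonup> 'h" and u :: 'h
  assumes self_adjoint: "self_adjoint_in UNIV A" and nonzero: "u \<noteq> 0"
begin

text \<open>For non-real \<open>z\<close> the resolvent is everywhere defined, so \<open>the\<close>
  never meets \<open>None\<close> there.\<close>

definition R :: "complex \<Rightarrow> 'h \<Rightarrow> 'h" where
  "R z f = the (resolvent A z f)"

text \<open>In the theorem this agrees with \<open>n\<close> off the real axis.\<close>

definition q :: "complex \<Rightarrow> complex" where
  "q z = cinner (R z u) u"

abbreviation "K \<equiv> orth_compl {u}"

abbreviation "Ahat \<equiv> compression K A"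

section \<open>The resolvent vectors of \<open>u\<close>\<close>

lemma lin: "linear_operator_in UNIV A"
  using self_adjoint by (simp add: self_adjoint_in_def)

lemma sym: "symmetric_op A"
  using self_adjoint by (rule self_adjoint_in_imp_symmetric)

lemma cinner_uu: "cinner u u \<noteq> 0"
  using nonzero by (simp add: cinner_eq_zero_iff)

lemma mem_K: "x \<in> K \<longleftrightarrow> cinner x u = 0"
  by (simp add: orth_compl_def)

lemma cinner_u_K: "x \<in> K \<Longrightarrow> cinner u x = 0"
  by (metis cinner_commute complex_cnj_zero mem_K)

lemma R: "z \<notin> \<real> \<Longrightarrow> A (R z f) = Some (f + z *\<^sub>C R z f)"
  using self_adjoint_range [OF self_adjoint, of z f] resolvent_eq_SomeI [OF lin sym, of z]
  unfolding R_def by fastforce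

text \<open>Scalar form of the resolvent identity: move \<open>A\<close> from \<open>R z u\<close>
  to \<open>R w u\<close> by symmetry.\<close>

lemma q_cross:
  assumes "z \<notin> \<real>" "w \<notin> \<real>"
  shows "(z - cnj w) * cinner (R z u) (R w u) = q z - cnj (q w)"
  using symmetric_opD [OF sym R R, OF assms, of u u] cinner_commute [of u "R w u"]
  by (simp add: q_def cinner_simps algebra_simps)

text \<open>If \<open>q z\<close> vanished, \<open>q_cross\<close> with \<open>w = z\<close> would
  give \<open>R z u = 0\<close>, and applying \<open>A - z\<close> would give
  \<open>u = 0\<close>.\<close>

lemma q_nonzero:
  assumes z: "z \<notin> \<real>"
  shows "q z \<noteq> 0"
proof
  assume "q z = 0"
  with q_cross [OF z z] have "(z - cnj z) * cinner (R z u) (R z u) = 0" by simp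
  moreover have "z - cnj z \<noteq> 0" using z by (simp add: Reals_cnj_iff)
  ultimately have "R z u = 0" by (simp add: cinner_eq_zero_iff)
  with R [OF z, of u] linear_operator_in_scaleC [OF lin R [OF z, of u], of 0] nonzero
  show False by simp
qed

section \<open>The projection onto \<open>K\<close> and self-adjointness of the compression\<close>

lemma P_eq: "orth_proj K x = x - (cinner x u / cinner u u) *\<^sub>C u"
  by (rule orth_proj_orth_compl_singleton [OF nonzero])

lemma P_in_K: "orth_proj K x \<in> K"
  using cinner_uu by (simp add: P_eq mem_K cinner_simps)

lemma cinner_P_left: "y \<in> K \<Longrightarrow> cinner (orth_proj K x) y = cinner x y"
  by (simp add: P_eq cinner_simps cinner_u_K)

lemma cinner_P_right: "y \<in> K \<Longrightarrow> cinner y (orth_proj K x) = cinner y x"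
  by (simp add: P_eq cinner_simps mem_K)

lemma Ahat_eq_Some_iff: "Ahat x = Some y \<longleftrightarrow> x \<in> K \<and> (\<exists>x'. A x = Some x' \<and> y = orth_proj K x')"
  by (auto simp: compression_def)

text \<open>The form in which the compression is computed below: split \<open>A x\<close> into a
  vector of \<open>K\<close> and a multiple of \<open>u\<close>, and drop the latter.\<close>

lemma Ahat_SomeI:
  assumes "x \<in> K" "A x = Some (g + c *\<^sub>C u)" "g \<in> K"
  shows "Ahat x = Some g"
proof -
  have "orth_proj K (g + c *\<^sub>C u) = g"
    using assms(3) cinner_uu by (simp add: P_eq mem_K cinner_simps)
  with assms show ?thesis by (auto simp: Ahat_eq_Some_iff)
qed

lemma linear_Ahat: "linear_operator_in K Ahat"
proof -
  have D: "dom Ahat = K \<inter> dom A"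
    by (auto simp: compression_def split: if_splits)
  have A0: "csubspace (dom A)"
    using lin by (simp add: linear_operator_in_def)
  have hat: "the (Ahat x) = orth_proj K (the (A x))" if "x \<in> K \<inter> dom A" for x
    using that by (auto simp: compression_def)
  have CD: "csubspace (K \<inter> dom A)"
    using A0 csubspace_orth_compl [of "{u}"] unfolding csubspace_def by blast
  show ?thesis
    unfolding linear_operator_in_def D
  proof (intro conjI ballI allI)
    show "ran Ahat \<subseteq> K" using P_in_K by (auto simp: ran_def Ahat_eq_Some_iff)
    fix x assume x: "x \<in> K \<inter> dom A"
    then obtain x' where x': "A x = Some x'" by auto
    have s: "the (A x) = x'" using x' by simp
    show "the (Ahat (c *\<^sub>C x)) = c *\<^sub>C the (Ahat x)" for c
    proof -
      have "c *\<^sub>C x \<in> K \<inter> dom A" using x CD by (simp add: csubspace_def)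
      then show ?thesis
        using x linear_operator_in_scaleC [OF lin x', of c]
        by (simp only: hat s) (simp add: P_eq cinner_simps scaleC_algebra)
    qed
    fix y assume y: "y \<in> K \<inter> dom A"
    then obtain y' where y': "A y = Some y'" by auto
    have s': "the (A y) = y'" using y' by simp
    have "x + y \<in> K \<inter> dom A" using x y CD unfolding csubspace_def by blast
    then show "the (Ahat (x + y)) = the (Ahat x) + the (Ahat y)"
      using x y linear_operator_in_add [OF lin x' y']
      by (simp only: hat s s') (simp add: P_eq cinner_simps scaleC_algebra add_divide_distrib)
  qed (use CD in auto)
qed

lemma symmetric_Ahat: "symmetric_op Ahat"
  unfolding symmetric_op_def Ahat_eq_Some_iff
  using symmetric_opD [OF sym] by (auto simp: cinner_P_left cinner_P_right)

lemma i_nonreal: "\<i> \<notin> \<real>"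
  by (simp add: complex_is_Real_iff)

text \<open>Approximate \<open>x\<close> by vectors of \<open>dom A\<close> and correct each to be
  orthogonal to \<open>u\<close>. The correction uses \<open>e\<close>, a domain vector with
  \<open>cinner e u \<noteq> 0\<close>, since \<open>u\<close> itself may lie outside
  \<open>dom A\<close>; it tends to zero because \<open>x\<close> is orthogonal to
  \<open>u\<close>.\<close>

lemma dense_Ahat: "K \<subseteq> closure (dom Ahat)"
proof
  fix x assume x: "x \<in> K"
  have "closure (dom A) = UNIV"
    using self_adjoint by (auto simp: self_adjoint_in_def)
  then obtain d where d: "\<And>n. d n \<in> dom A" and lim: "d \<longlonglongrightarrow> x"
    using closure_sequential [of x "dom A"] by auto
  define e where "e = R \<i> u"
  have e: "e \<in> dom A" "cinner e u \<noteq> 0"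
    using R [OF i_nonreal, of u] q_nonzero [OF i_nonreal] by (auto simp: e_def q_def)
  define d' where "d' n = d n - cinner (d n) u *\<^sub>C (1 / cinner e u) *\<^sub>C e" for n
  have "d' n \<in> dom Ahat" for n
  proof -
    have "csubspace (dom A)" using lin by (simp add: linear_operator_in_def)
    then have "d' n \<in> dom A"
      unfolding d'_def using d e(1) csubspace_diff by (metis csubspace_def)
    moreover have "d' n \<in> K"
      using e(2) by (simp add: d'_def mem_K cinner_simps)
    ultimately show ?thesis by (auto simp: compression_def)
  qed
  moreover have "d' \<longlonglongrightarrow> x"
  proof (rule Lim_transform [OF lim])
    have "(\<lambda>n. norm (cinner (d n) u) * norm ((1 / cinner e u) *\<^sub>C e)) \<longlonglongrightarrow> norm (cinner x u) * norm ((1 / cinner e u) *\<^sub>C e)"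
      by (intro tendsto_intros bounded_linear.tendsto [OF bounded_linear_cinner_left lim])
    also have "cinner x u = 0" using x by (simp add: mem_K)
    finally show "(\<lambda>n. d' n - d n) \<longlonglongrightarrow> 0"
      by (intro tendsto_norm_zero_cancel [of "\<lambda>n. d' n - d n"]) (simp add: d'_def norm_scaleC del: complex_inner.scale_scale)
  qed
  ultimately show "x \<in> closure (dom Ahat)"
    using closure_sequential by blast
qed

text \<open>Subtracting a multiple of \<open>R z u\<close> changes the image under
  \<open>A - z\<close> only by a multiple of \<open>u\<close>, which the compression removes; the
  multiple is chosen to make the solution orthogonal to \<open>u\<close>.\<close>

lemma range_Ahat:
  assumes f: "f \<in> K" and z: "z \<notin> \<real>"
  shows "\<exists>x. Ahat x = Some (f + z *\<^sub>C x)"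
proof -
  define c where "c = cinner (R z f) u / q z"
  define x where "x = R z f - c *\<^sub>C R z u"
  have x: "x \<in> K"
    using q_nonzero [OF z] by (simp add: x_def mem_K cinner_simps c_def flip: q_def)
  have "A x = Some (f + z *\<^sub>C R z f - c *\<^sub>C (u + z *\<^sub>C R z u))"
    unfolding x_def by (intro linear_operator_in_diff [OF lin] linear_operator_in_scaleC [OF lin] R z)
  also have "f + z *\<^sub>C R z f - c *\<^sub>C (u + z *\<^sub>C R z u) = (f + z *\<^sub>C x) + (- c) *\<^sub>C u"
    by (simp add: x_def scaleC_algebra algebra_simps)
  finally have "A x = Some ((f + z *\<^sub>C x) + (- c) *\<^sub>C u)" .
  from Ahat_SomeI [OF x this] f x have "Ahat x = Some (f + z *\<^sub>C x)"
    by (simp add: mem_K cinner_simps)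
  then show ?thesis by blast
qed

lemma self_adjoint_Ahat: "self_adjoint_in K Ahat"
  using range_Ahat [of _ \<i>] range_Ahat [of _ "cnj \<i>"] i_nonreal
  by (intro self_adjoint_inI_range [where z = \<i>] csubspace_orth_compl closed_orth_compl
      linear_Ahat dense_Ahat symmetric_Ahat) auto

lemmas resolvent_Ahat = resolvent_eq_SomeI [OF linear_Ahat symmetric_Ahat]

text \<open>Both terms have inner product 1 with \<open>u\<close> for non-real \<open>z\<close>, so
  the difference lies in \<open>K\<close>. By \<open>P_R\<close> it is the projection of
  \<open>R z u\<close> divided by \<open>q z\<close>; thus \<open>vhat\<close> at \<open>w\<close>
  is \<open>norm u\<close> times \<open>\<gamma> w\<close>.\<close>

definition \<gamma> :: "complex \<Rightarrow> 'h" where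
  "\<gamma> z = (1 / q z) *\<^sub>C R z u - (1 / cinner u u) *\<^sub>C u"

lemma \<gamma>_in_K: "z \<notin> \<real> \<Longrightarrow> \<gamma> z \<in> K"
  using q_nonzero [of z] cinner_uu by (simp add: \<gamma>_def mem_K cinner_simps flip: q_def)

lemma P_R: "z \<notin> \<real> \<Longrightarrow> orth_proj K (R z u) = q z *\<^sub>C \<gamma> z"
  using q_nonzero [of z] by (simp add: P_eq \<gamma>_def scaleC_algebra flip: q_def)

text \<open>For \<open>z \<noteq> w\<close> the claim amounts to the resolvent of
  \<open>Ahat\<close> at \<open>z\<close> sending \<open>\<gamma> w\<close> to the difference
  quotient of \<open>\<gamma> z\<close> and \<open>\<gamma> w\<close>. For \<open>z = w\<close> the
  composite acts as the identity.\<close>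

lemma Ahat_shift_resolvent_\<gamma>:
  assumes z: "z \<notin> \<real>" and w: "w \<notin> \<real>"
  shows "(op_shift Ahat w \<circ>\<^sub>m resolvent Ahat z) (c *\<^sub>C \<gamma> w) = Some (c *\<^sub>C \<gamma> z)"
proof (cases "z = w")
  case True
  have "c *\<^sub>C \<gamma> w \<in> K"
    using \<gamma>_in_K [OF w] by (simp add: mem_K cinner_simps)
  then obtain x where x: "Ahat x = Some (c *\<^sub>C \<gamma> w + z *\<^sub>C x)"
    using range_Ahat [OF _ z] by blast
  from resolvent_Ahat [OF z this] x show ?thesis
    by (simp add: map_comp_def op_shift_def True)
next
  case False
  define b where "b = c / (z - w)"
  \<comment> \<open>This is \<open>b *\<^sub>C (\<gamma> z - \<gamma> w)\<close>, in which the
    multiples of \<open>u\<close> cancel, so \<open>x\<close> lies in \<open>dom A\<close>.\<close>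
  define x where "x = b *\<^sub>C ((1 / q z) *\<^sub>C R z u - (1 / q w) *\<^sub>C R w u)"
  have b: "b * z - b * w = c" using False by (simp add: b_def flip: diff_divide_distrib right_diff_distrib)
  have x: "x \<in> K"
    using q_nonzero [OF z] q_nonzero [OF w]
    by (simp add: x_def mem_K cinner_simps flip: q_def)
  have zx: "z *\<^sub>C x = w *\<^sub>C x + c *\<^sub>C ((1 / q z) *\<^sub>C R z u - (1 / q w) *\<^sub>C R w u)"
    unfolding b [symmetric] x_def
    by (simp add: scaleC_algebra algebra_simps)
  have "A x = Some (b *\<^sub>C ((1 / q z) *\<^sub>C (u + z *\<^sub>C R z u) - (1 / q w) *\<^sub>C (u + w *\<^sub>C R w u)))"
    unfolding x_def
    by (intro linear_operator_in_diff [OF lin] linear_operator_in_scaleC [OF lin] R z w)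
  also have "b *\<^sub>C ((1 / q z) *\<^sub>C (u + z *\<^sub>C R z u) - (1 / q w) *\<^sub>C (u + w *\<^sub>C R w u))
    = c *\<^sub>C (1 / q w) *\<^sub>C R w u + z *\<^sub>C x + (b * (1 / q z - 1 / q w)) *\<^sub>C u"
    unfolding b [symmetric] x_def
    by (simp add: scaleC_algebra algebra_simps)
  also have "\<dots> = (c *\<^sub>C \<gamma> w + z *\<^sub>C x) + (b * (1 / q z - 1 / q w) + c / cinner u u) *\<^sub>C u"
    by (simp add: \<gamma>_def scaleC_algebra algebra_simps)
  finally have Ax: "Ahat x = Some (c *\<^sub>C \<gamma> w + z *\<^sub>C x)"
    by (intro Ahat_SomeI [OF x]) (use \<gamma>_in_K [OF w] x in \<open>auto simp: mem_K cinner_simps\<close>)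
  have "c *\<^sub>C \<gamma> w + z *\<^sub>C x - w *\<^sub>C x = c *\<^sub>C \<gamma> z"
    unfolding zx by (simp add: \<gamma>_def scaleC_algebra algebra_simps)
  with resolvent_Ahat [OF z Ax] Ax show ?thesis
    by (simp add: map_comp_def op_shift_def)
qed

text \<open>Expanding the inner product leaves \<open>cinner (R z u) (R w u)\<close>, which
  \<open>q_cross\<close> evaluates. The right-hand side is the difference of the Schur transform at
  \<open>z\<close> and its conjugate at \<open>w\<close>, where the real constant
  \<open>s1 / s0\<close> cancels.\<close>

lemma \<gamma>_cross:
  assumes z: "z \<notin> \<real>" and w: "w \<notin> \<real>"
  shows "(z - cnj w) * (cinner u u * cinner (\<gamma> z) (\<gamma> w)) =
    cinner u u / cnj (q w) - cinner u u / q z - (z - cnj w)"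
proof -
  have nz: "q z \<noteq> 0" "q w \<noteq> 0" using q_nonzero z w by auto
  have cuu: "cnj (cinner u u) = cinner u u" by (metis cinner_commute)
  have "cinner u u * cinner (\<gamma> z) (\<gamma> w) =
      cinner u u * cinner (R z u) (R w u) / (q z * cnj (q w)) - 1"
    using nz cinner_uu cinner_commute [of u "R w u"]
    by (simp add: \<gamma>_def cinner_simps cuu field_simps flip: q_def)
  then have "(z - cnj w) * (cinner u u * cinner (\<gamma> z) (\<gamma> w)) =
      cinner u u * ((z - cnj w) * cinner (R z u) (R w u)) / (q z * cnj (q w)) - (z - cnj w)"
    by (simp only: right_diff_distrib times_divide_eq_right mult.left_commute mult_1_right)
  also have "\<dots> = cinner u u / cnj (q w) - cinner u u / q z - (z - cnj w)"
    unfolding q_cross [OF z w] using nz by (simp add: field_simps)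
  finally show ?thesis .
qed

text \<open>The vector \<open>u - (cinner u u / q z) *\<^sub>C R z u\<close> is orthogonal to
  \<open>u\<close>, and \<open>A - z\<close> maps it to \<open>u'\<close> plus a multiple of
  \<open>u\<close>. So it is the resolvent of \<open>Ahat\<close> applied to the projection of
  \<open>u'\<close>. The scalar \<open>c\<close> will be \<open>1 / norm u\<close>.\<close>

lemma cinner_resolvent_Ahat:
  assumes Au: "A u = Some u'" and z: "z \<notin> \<real>"
  shows "cinner (the (resolvent Ahat z (c *\<^sub>C orth_proj K u'))) (c *\<^sub>C orth_proj K u') =
    c * cnj c * (- (cinner u u)\<^sup>2 / q z - z * cinner u u + cinner u u')"
proof -
  let ?g = "orth_proj K u'"
  define x where "x = (- cinner u u) *\<^sub>C \<gamma> z"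
  have x: "x \<in> K" using \<gamma>_in_K [OF z] by (simp add: x_def mem_K cinner_simps)
  have x_eq: "x = u - (cinner u u / q z) *\<^sub>C R z u"
    using cinner_uu by (simp add: x_def \<gamma>_def scaleC_algebra)
  have "A x = Some (u' - (cinner u u / q z) *\<^sub>C (u + z *\<^sub>C R z u))"
    unfolding x_eq by (intro linear_operator_in_diff [OF lin] linear_operator_in_scaleC [OF lin] R z Au)
  also have "u' - (cinner u u / q z) *\<^sub>C (u + z *\<^sub>C R z u) =
      (?g + z *\<^sub>C x) + (cinner u' u / cinner u u - z - cinner u u / q z) *\<^sub>C u"
    by (simp add: x_eq P_eq scaleC_algebra algebra_simps)
  finally have "Ahat x = Some (?g + z *\<^sub>C x)"
    by (intro Ahat_SomeI [OF x]) (use P_in_K [of u'] x in \<open>auto simp: mem_K cinner_simps\<close>)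
  from linear_operator_in_scaleC [OF linear_Ahat this, of c]
  have "Ahat (c *\<^sub>C x) = Some (c *\<^sub>C ?g + z *\<^sub>C c *\<^sub>C x)"
    by (simp add: scaleC_algebra mult.commute)
  from resolvent_Ahat [OF z this]
  have "cinner (the (resolvent Ahat z (c *\<^sub>C ?g))) (c *\<^sub>C ?g) = c * cnj c * cinner x u'"
    by (simp add: cinner_simps cinner_P_right [OF x])
  also have "cinner (R z u) u' = cinner u u + z * q z"
    using symmetric_opD [OF sym R [OF z] Au, of u] by (simp add: q_def cinner_simps)
  then have "cinner x u' = - (cinner u u)\<^sup>2 / q z - z * cinner u u + cinner u u'"
    using q_nonzero [OF z] by (simp add: x_eq cinner_simps field_simps power2_eq_square)
  finally show ?thesis .
qed

end

section \<open>A growth condition placing \<open>u\<close> in the domain of \<open>A\<close>, and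
  the first moment\<close>

context self_adjoint_vector
begin

text \<open>For non-real \<open>z\<close> this is \<open>A (R z u)\<close>; it is also the error
  when \<open>u\<close> is approximated by the domain vector
  \<open>- z *\<^sub>C R z u\<close>.\<close>

definition AR :: "complex \<Rightarrow> 'h" where
  "AR z = u + z *\<^sub>C R z u"

lemma A_R_u: "z \<notin> \<real> \<Longrightarrow> A (R z u) = Some (AR z)"
  by (simp add: AR_def R)

text \<open>With \<open>x = R z u\<close>, \<open>cinner (A x) x\<close> is real, so
  \<open>cinner (A x) (z *\<^sub>C x)\<close> is purely imaginary on the imaginary axis. Only
  \<open>cinner (AR z) u\<close> contributes to the real part.\<close>

lemma norm_AR:
  assumes "Re z = 0" and z: "z \<notin> \<real>"
  shows "(norm (AR z))\<^sup>2 = Re (cinner u u + z * q z)"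
proof -
  have "Re (cinner (AR z) (z *\<^sub>C R z u)) = 0"
    using symmetric_op_inner_real [OF sym A_R_u [OF z]] assms(1)
    by (simp add: cinner_simps complex_is_Real_iff)
  moreover have "cinner (AR z) (AR z) = cinner (AR z) u + cinner (AR z) (z *\<^sub>C R z u)"
    by (simp add: AR_def cinner_add_right)
  moreover have "cinner (AR z) u = cinner u u + z * q z"
    by (simp add: AR_def cinner_simps q_def)
  moreover have "Re (cinner (AR z) (AR z)) = (norm (AR z))\<^sup>2"
    by (simp add: cinner_self flip: of_real_power)
  ultimately show ?thesis by simp
qed

text \<open>The domain vectors \<open>- z *\<^sub>C R z u\<close> tend to \<open>u\<close> while
  their images under \<open>A\<close> stay bounded. Hence \<open>w \<mapsto> cinner (A w) u\<close>
  is bounded by \<open>C\<close>; its Riesz vector is \<open>A u\<close> by maximality.\<close>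

lemma domain_of_bounded_AR:
  assumes F: "F \<noteq> bot" "eventually (\<lambda>z. z \<notin> \<real>) F"
    and lim: "(AR \<longlongrightarrow> 0) F" and bd: "eventually (\<lambda>z. cmod z * norm (AR z) \<le> C) F"
  shows "u \<in> dom A"
proof -
  have bound: "cmod (cinner w' u) \<le> C * norm w" if w: "A w = Some w'" for w w'
  proof (rule tendsto_lowerbound)
    have "((\<lambda>z. norm w' * norm (AR z) + C * norm w) \<longlongrightarrow> norm w' * norm (0::'h) + C * norm w) F"
      by (intro tendsto_intros lim)
    then show "((\<lambda>z. norm w' * norm (AR z) + C * norm w) \<longlongrightarrow> C * norm w) F" by simp
    show "eventually (\<lambda>z. cmod (cinner w' u) \<le> norm w' * norm (AR z) + C * norm w) F"
      using F(2) bd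
    proof eventually_elim
      case (elim z)
      \<comment> \<open>Write \<open>u\<close> as \<open>AR z - z *\<^sub>C R z u\<close> and move
        \<open>A\<close> from \<open>w\<close> to \<open>R z u\<close>. The first term vanishes in
        the limit, the second is bounded by \<open>C * norm w\<close>.\<close>
      have "cinner w' u = cinner w' (AR z) - cnj z * cinner w (AR z)"
        using symmetric_opD [OF sym w A_R_u] elim(1) by (simp add: AR_def cinner_simps)
      also have "cmod \<dots> \<le> cmod (cinner w' (AR z)) + cmod z * cmod (cinner w (AR z))"
        using norm_triangle_ineq4 [of "cinner w' (AR z)" "cnj z * cinner w (AR z)"]
        by (simp add: norm_mult)
      also have "\<dots> \<le> norm w' * norm (AR z) + cmod z * (norm w * norm (AR z))"
        by (intro add_mono mult_left_mono cinner_Cauchy_Schwarz) auto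
      also have "cmod z * (norm w * norm (AR z)) \<le> C * norm w"
        using mult_right_mono [OF elim(2) norm_ge_zero [of w]] by (simp add: mult_ac)
      finally show ?case by simp
    qed
  qed (fact F)
  have S: "csubspace (dom A)" using lin by (simp add: linear_operator_in_def)
  obtain g where g: "\<And>w. w \<in> dom A \<Longrightarrow> cinner (the (A w)) u = cinner w g"
  proof (rule Riesz_representation [OF S, of "\<lambda>w. cinner (the (A w)) u" C])
    show "cinner (the (A (x + y))) u = cinner (the (A x)) u + cinner (the (A y)) u"
      if "x \<in> dom A" "y \<in> dom A" for x y
      using lin that by (simp add: linear_operator_in_def cinner_simps)
    show "cinner (the (A (c *\<^sub>C x))) u = c * cinner (the (A x)) u" if "x \<in> dom A" for c x
      using lin that by (simp add: linear_operator_in_def cinner_simps)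
    show "cmod (cinner (the (A x)) u) \<le> C * norm x" if "x \<in> dom A" for x
      using that bound by auto
  qed blast
  have "A u = Some g"
    by (rule self_adjoint_in_maximal [OF self_adjoint]) (use g in force)+
  then show ?thesis by blast
qed

text \<open>By symmetry \<open>cinner (R z u) u' = cinner (AR z) u\<close>, so the expression equals
  \<open>cinner (AR z - u) u'\<close>.\<close>

lemma tendsto_first_moment:
  assumes F: "eventually (\<lambda>z. z \<notin> \<real>) F" and lim: "(AR \<longlongrightarrow> 0) F" and Au: "A u = Some u'"
  shows "((\<lambda>z. z * (cinner u u + z * q z)) \<longlongrightarrow> - cinner u u') F"
proof (rule Lim_transform_eventually)
  have "((\<lambda>z. cinner (AR z) u' - cinner u u') \<longlongrightarrow> cinner 0 u' - cinner u u') F"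
    by (intro tendsto_intros bounded_linear.tendsto [OF bounded_linear_cinner_left] lim)
  then show "((\<lambda>z. cinner (AR z) u' - cinner u u') \<longlongrightarrow> - cinner u u') F" by simp
  show "eventually (\<lambda>z. cinner (AR z) u' - cinner u u' = z * (cinner u u + z * q z)) F"
    using F
  proof eventually_elim
    case (elim z)
    have "cinner (R z u) u' = cinner (AR z) u"
      using symmetric_opD [OF sym A_R_u [OF elim] Au] by simp
    also have "\<dots> = cinner u u + z * q z"
      by (simp add: AR_def cinner_simps q_def)
    finally show ?case
      by (simp add: AR_def cinner_simps)
  qed
qed

end

section \<open>Asymptotics along the imaginary axis\<close>

lemma imag_infinity_neq_bot: "imag_infinity \<noteq> bot"
  by (simp add: imag_infinity_def filtermap_bot_iff trivial_limit_at_infinity)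

lemma eventually_imag_infinity: "eventually (\<lambda>z. Re z = 0 \<and> z \<notin> \<real>) imag_infinity"
  unfolding imag_infinity_def eventually_filtermap eventually_at_infinity
  by (intro exI [of _ 1]) (auto simp: complex_is_Real_iff)

lemma eventually_nonreal: "eventually (\<lambda>z. z \<notin> \<real>) imag_infinity"
  using eventually_imag_infinity by eventually_elim simp

lemma smallo_inverse_power_iff:
  "f \<in> o[imag_infinity](\<lambda>z. 1 / z ^ k) \<longleftrightarrow> ((\<lambda>z. z ^ k * f z) \<longlongrightarrow> 0) imag_infinity"
proof -
  have *: "eventually (\<lambda>z. 1 / z ^ k \<noteq> (0::complex)) imag_infinity"
    using eventually_nonreal by eventually_elim auto
  have "f \<in> o[imag_infinity](\<lambda>z. 1 / z ^ k) \<longleftrightarrow> ((\<lambda>z. f z / (1 / z ^ k)) \<longlongrightarrow> 0) imag_infinity"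
    using smalloD_tendsto smalloI_tendsto [OF _ *] by blast
  then show ?thesis by (simp add: mult.commute)
qed

lemma tendsto_moment0_iff:
  "(\<lambda>z. f z - (- s / z)) \<in> o[imag_infinity](\<lambda>z. 1 / z) \<longleftrightarrow> ((\<lambda>z. z * f z) \<longlongrightarrow> - s) imag_infinity"
proof -
  have "(\<lambda>z. f z - (- s / z)) \<in> o[imag_infinity](\<lambda>z. 1 / z) \<longleftrightarrow>
      ((\<lambda>z. z * (f z - (- s / z))) \<longlongrightarrow> 0) imag_infinity"
    using smallo_inverse_power_iff [of _ 1] by simp
  also have "\<dots> \<longleftrightarrow> ((\<lambda>z. z * f z - (- s)) \<longlongrightarrow> 0) imag_infinity"
    by (rule tendsto_cong, use eventually_nonreal in eventually_elim) (auto simp: field_simps)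
  finally show ?thesis by (simp only: Lim_null [symmetric])
qed

text \<open>The left side is \<open>z ^ 3\<close> times the remainder of \<open>n\<close> after its
  first two terms. Read one way this bounds that remainder by the behaviour of the transform; read
  the other way it yields the leading coefficient of the transform.\<close>

lemma Schur_transform_identity:
  assumes "z \<noteq> 0" "s0 \<noteq> 0" "n z \<noteq> 0"
  shows "z\<^sup>2 * (of_real s0 + z * n z) + of_real s1 * z =
    - (z * n z) * (z * Schur_transform s0 s1 n z) + of_real (s1 / s0) * (z * (of_real s0 + z * n z))"
  using assms by (simp add: Schur_transform_def field_simps power2_eq_square)

text \<open>Solve the identity for \<open>z\<close> times the transform and divide by
  \<open>z * n z\<close>, which tends to \<open>- s0\<close>, a non-zero limit.\<close>

lemma Schur_transform_moment0:
  assumes "s0 \<noteq> 0"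
    and n: "eventually (\<lambda>z. n z \<noteq> 0) imag_infinity"
    and m0: "((\<lambda>z. z * n z) \<longlongrightarrow> - of_real s0) imag_infinity"
    and m1: "((\<lambda>z. z * (of_real s0 + z * n z)) \<longlongrightarrow> - of_real s1) imag_infinity"
    and m2: "((\<lambda>z. z\<^sup>2 * (of_real s0 + z * n z) + of_real s1 * z) \<longlongrightarrow> - of_real s2) imag_infinity"
  shows "((\<lambda>z. z * Schur_transform s0 s1 n z) \<longlongrightarrow> - of_real (s2 / s0 - (s1 / s0)\<^sup>2)) imag_infinity"
proof (rule Lim_transform_eventually)
  let ?E = "\<lambda>z. z\<^sup>2 * (of_real s0 + z * n z) + of_real s1 * z"
  let ?Q = "\<lambda>z. (of_real (s1 / s0) * (z * (of_real s0 + z * n z)) - ?E z) / (z * n z)"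
  have "(?Q \<longlongrightarrow> (of_real (s1 / s0) * (- of_real s1) - (- of_real s2)) / (- of_real s0)) imag_infinity"
    using \<open>s0 \<noteq> 0\<close> by (intro tendsto_intros m0 m1 m2) auto
  also have "(of_real (s1 / s0) * (- of_real s1) - (- of_real s2)) / (- of_real s0) =
      (- of_real (s2 / s0 - (s1 / s0)\<^sup>2) :: complex)"
    using \<open>s0 \<noteq> 0\<close> by (simp add: field_simps power2_eq_square)
  finally show "(?Q \<longlongrightarrow> - of_real (s2 / s0 - (s1 / s0)\<^sup>2)) imag_infinity" .
  show "eventually (\<lambda>z. ?Q z = z * Schur_transform s0 s1 n z) imag_infinity"
    using eventually_nonreal n
  proof eventually_elim
    case (elim z)
    then have "z \<noteq> 0" by auto
    with elim Schur_transform_identity [OF _ \<open>s0 \<noteq> 0\<close>, of z n s1]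
    have "of_real (s1 / s0) * (z * (of_real s0 + z * n z)) - ?E z = (z * n z) * (z * Schur_transform s0 s1 n z)"
      by simp
    then show ?case using elim \<open>z \<noteq> 0\<close> by simp
  qed
qed

section \<open>The Schur transform\<close>

text \<open>Here \<open>v\<close> is \<open>norm u\<close> times \<open>\<gamma> w\<close>, which
  the shifted resolvent carries to \<open>norm u\<close> times \<open>\<gamma> z\<close>. With
  \<open>(norm u)\<^sup>2 = s0\<close> the formula becomes \<open>\<gamma>_cross\<close>.\<close>

lemma Schur_transform_resolvent_representation:
  fixes A :: "'h::complex_hilbert \<rightharpoonup> 'h"
  assumes "self_adjoint_vector A u" and s0: "cinner u u = of_real s0" "s0 \<noteq> 0"
    and n: "\<And>z. z \<notin> \<real> \<Longrightarrow> n z = cinner (the (resolvent A z u)) u"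
    and z: "z \<notin> \<real>" and w: "w \<notin> \<real>"
  defines "K \<equiv> orth_compl {u}"
  defines "v \<equiv> (of_real (norm u) / cinner (the (resolvent A w u)) u) *\<^sub>C
      orth_proj K (the (resolvent A w u))"
  shows "v \<in> K"
    and "Schur_transform s0 s1 n z = cnj (Schur_transform s0 s1 n w) + (z - cnj w) *
      cinner (the ((op_shift (compression K A) w \<circ>\<^sub>m resolvent (compression K A) z) v)) v"
proof -
  interpret self_adjoint_vector A u by fact
  have nq: "n x = q x" if "x \<notin> \<real>" for x
    using n [OF that] by (simp add: q_def R_def)
  have v: "v = of_real (norm u) *\<^sub>C \<gamma> w"
    using P_R [OF w] q_nonzero [OF w] unfolding v_def K_def R_def [symmetric] q_def [symmetric]
    by simp
  show "v \<in> K"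
    using \<gamma>_in_K [OF w] by (simp add: v K_def mem_K cinner_simps)
  have uu: "of_real (norm u) * (of_real (norm u) * x) = cinner u u * x" for x :: complex
    by (simp add: cinner_self power2_eq_square)
  have "(z - cnj w) * cinner (of_real (norm u) *\<^sub>C \<gamma> z) v = (z - cnj w) * (cinner u u * cinner (\<gamma> z) (\<gamma> w))"
    by (simp add: v cinner_simps uu)
  also have "\<dots> = Schur_transform s0 s1 n z - cnj (Schur_transform s0 s1 n w)"
    unfolding \<gamma>_cross [OF z w] by (simp add: Schur_transform_def nq z w s0)
  finally show "Schur_transform s0 s1 n z = cnj (Schur_transform s0 s1 n w) + (z - cnj w) *
      cinner (the ((op_shift (compression K A) w \<circ>\<^sub>m resolvent (compression K A) z) v)) v"
    using Ahat_shift_resolvent_\<gamma> [OF z w, of "of_real (norm u)"] by (simp add: v K_def)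
qed

theorem theorem3p1:
  fixes n :: "complex \<Rightarrow> complex"
    and s0 s1 :: real
    and A :: "'h::complex_hilbert \<rightharpoonup> 'h"
    and u :: 'h
  assumes "n \<in> Nevanlinna"
    and "(\<lambda>z. n z - (- of_real s0 / z)) \<in> o[imag_infinity](\<lambda>z. 1 / z)"
    and "(\<lambda>z. n z - (- of_real s0 / z - of_real s1 / z ^ 2)) \<in> o[imag_infinity](\<lambda>z. 1 / z ^ 2)"
    and "s0 \<noteq> 0"
    and "self_adjoint_in UNIV A"
    and "cinner u u = of_real s0"
    and "\<And>z. z \<notin> \<real> \<Longrightarrow> n z = cinner (the (resolvent A z u)) u"
  shows
    "let nhat = Schur_transform s0 s1 n;
         Hhat = orth_compl {u};
         Phat = orth_proj Hhat;
         Ahat = compression Hhat A;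
         uhat = (1 / of_real (norm u)) *\<^sub>C Phat (the (A u))
     in self_adjoint_in Hhat Ahat \<and>
        (\<forall>z0. z0 \<notin> \<real> \<longrightarrow>
           (let vhat = (of_real (norm u) / cinner (the (resolvent A z0 u)) u) *\<^sub>C
                         Phat (the (resolvent A z0 u))
            in vhat \<in> Hhat \<and>
               (\<forall>z. z \<notin> \<real> \<longrightarrow>
                  nhat z = cnj (nhat z0) + (z - cnj z0) *
                    cinner (the ((op_shift Ahat z0 \<circ>\<^sub>m resolvent Ahat z) vhat)) vhat))) \<and>
        ((\<exists>shat0::real. (\<lambda>z. nhat z - (- of_real shat0 / z)) \<in> o[imag_infinity](\<lambda>z. 1 / z)) \<longrightarrow>
           u \<in> dom A \<and> uhat \<in> Hhat \<and>
           (\<forall>z. z \<notin> \<real> \<longrightarrow> nhat z = cinner (the (resolvent Ahat z uhat)) uhat)) \<and>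
        ((\<exists>s2::real. (\<lambda>z. n z - (- of_real s0 / z - of_real s1 / z ^ 2 - of_real s2 / z ^ 3))
              \<in> o[imag_infinity](\<lambda>z. 1 / z ^ 3)) \<longrightarrow>
           (\<exists>shat0::real. (\<lambda>z. nhat z - (- of_real shat0 / z)) \<in> o[imag_infinity](\<lambda>z. 1 / z)))"
proof -
  have u: "u \<noteq> 0" using assms(4,6) by auto
  interpret self_adjoint_vector A u
    using assms(5) u by unfold_locales
  let ?nh = "Schur_transform s0 s1 n"
  have s0: "cinner u u = of_real s0" by fact
  have norm_u: "(norm u)\<^sup>2 = s0"
    using s0 unfolding cinner_self by (simp only: of_real_eq_iff)
  have nq: "n z = q z" if "z \<notin> \<real>" for z
    using assms(7) [OF that] by (simp add: q_def R_def)
  have n_nz: "eventually (\<lambda>z. n z \<noteq> 0) imag_infinity"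
    using eventually_nonreal by eventually_elim (simp add: nq q_nonzero)
  have m0: "((\<lambda>z. z * n z) \<longlongrightarrow> - of_real s0) imag_infinity"
    using assms(2) unfolding tendsto_moment0_iff .
  have "((\<lambda>z. z ^ 2 * (n z - (- of_real s0 / z - of_real s1 / z ^ 2))) \<longlongrightarrow> 0) imag_infinity"
    using assms(3) unfolding smallo_inverse_power_iff .
  also have "?this \<longleftrightarrow> ((\<lambda>z. z * (of_real s0 + z * n z) - (- of_real s1)) \<longlongrightarrow> 0) imag_infinity"
    by (rule tendsto_cong, use eventually_nonreal in eventually_elim)
       (auto simp: field_simps power2_eq_square)
  finally have m1: "((\<lambda>z. z * (of_real s0 + z * n z)) \<longlongrightarrow> - of_real s1) imag_infinity"
    by (simp only: Lim_null [symmetric])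
  \<comment> \<open>By \<open>norm_AR\<close> the squared norm is the real part of
    \<open>s0 + z * n z\<close>, which tends to 0.\<close>
  have AR0: "(AR \<longlongrightarrow> 0) imag_infinity"
  proof (rule tendsto_norm_zero_cancel, rule Lim_transform_eventually)
    have "((\<lambda>z. sqrt (Re (of_real s0 + z * n z))) \<longlongrightarrow> sqrt (Re (of_real s0 + - of_real s0))) imag_infinity"
      by (intro tendsto_intros m0)
    then show "((\<lambda>z. sqrt (Re (of_real s0 + z * n z))) \<longlongrightarrow> 0) imag_infinity" by simp
    show "eventually (\<lambda>z. sqrt (Re (of_real s0 + z * n z)) = norm (AR z)) imag_infinity"
      using eventually_imag_infinity
    proof eventually_elim
      case (elim z)
      then show ?case
        using norm_AR [of z] real_sqrt_abs [of "norm (AR z)"] by (simp add: nq s0)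
    qed
  qed
  have part3: "u \<in> dom A \<and>
      (\<forall>z. z \<notin> \<real> \<longrightarrow> ?nh z = cinner (the (resolvent Ahat z ((1 / of_real (norm u)) *\<^sub>C orth_proj K (the (A u)))))
        ((1 / of_real (norm u)) *\<^sub>C orth_proj K (the (A u))))"
    if "(\<lambda>z. ?nh z - (- of_real t / z)) \<in> o[imag_infinity](\<lambda>z. 1 / z)" for t :: real
  proof -
    let ?E = "\<lambda>z. z\<^sup>2 * (of_real s0 + z * n z) + of_real s1 * z"
    \<comment> \<open>The limit of \<open>?E\<close> read off from
      \<open>Schur_transform_identity\<close>, with the known limits inserted factor by
      factor.\<close>
    define L where "L = - (- of_real s0) * (- of_real t) + of_real (s1 / s0) * (- of_real s1 :: complex)"
    have nh0: "((\<lambda>z. z * ?nh z) \<longlongrightarrow> - of_real t) imag_infinity"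
      using that unfolding tendsto_moment0_iff .
    have E: "(?E \<longlongrightarrow> L) imag_infinity"
    proof (rule Lim_transform_eventually)
      show "((\<lambda>z. - (z * n z) * (z * ?nh z) + of_real (s1 / s0) * (z * (of_real s0 + z * n z)))
          \<longlongrightarrow> L) imag_infinity"
        unfolding L_def by (intro tendsto_intros m0 nh0 m1)
      show "eventually (\<lambda>z. - (z * n z) * (z * ?nh z) + of_real (s1 / s0) * (z * (of_real s0 + z * n z)) = ?E z)
          imag_infinity"
        using eventually_nonreal n_nz
        by eventually_elim (use \<open>s0 \<noteq> 0\<close> in \<open>subst Schur_transform_identity, auto\<close>)
    qed
    have "eventually (\<lambda>z. dist (?E z) L < 1) imag_infinity"
      using E by (rule tendstoD) simp
    then have "eventually (\<lambda>z. cmod z * norm (AR z) \<le> sqrt (cmod L + 1)) imag_infinity"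
      using eventually_imag_infinity
    proof eventually_elim
      case (elim z)
      then have z: "z = \<i> * of_real (Im z)" and nr: "z \<notin> \<real>" and "Re z = 0"
        by (auto simp: complex_eq_iff)
      have z2: "z\<^sup>2 = - of_real ((cmod z)\<^sup>2)"
        unfolding cmod_power2 using \<open>Re z = 0\<close> by (simp add: complex_eq_iff power2_eq_square)
      \<comment> \<open>On the imaginary axis \<open>s1 * z\<close> is purely imaginary and
        \<open>z\<^sup>2\<close> is negative, so only \<open>norm_AR\<close> remains in the real
        part.\<close>
      have "(cmod z * norm (AR z))\<^sup>2 = - Re (?E z)"
        unfolding z2 using \<open>Re z = 0\<close> norm_AR [OF \<open>Re z = 0\<close> nr]
        by (simp add: power_mult_distrib nq [OF nr] s0 flip: of_real_power)
      also have "\<dots> \<le> cmod (?E z)"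
        using abs_Re_le_cmod [of "?E z"] by linarith
      also have "\<dots> \<le> cmod L + 1"
        using elim norm_triangle_sub [of "?E z" L] by (simp add: dist_norm)
      finally show ?case
        by (rule real_le_rsqrt)
    qed
    with domain_of_bounded_AR [OF imag_infinity_neq_bot eventually_nonreal AR0]
    have dom: "u \<in> dom A" by blast
    then obtain u' where Au: "A u = Some u'" by blast
    \<comment> \<open>Two limits of the same function along a non-trivial filter agree.\<close>
    have s1: "cinner u u' = of_real s1"
      using tendsto_unique [OF imag_infinity_neq_bot _ m1, of "- cinner u u'"]
        tendsto_first_moment [OF eventually_nonreal AR0 Au]
        tendsto_cong [of "\<lambda>z. z * (cinner u u + z * q z)" "\<lambda>z. z * (of_real s0 + z * n z)" imag_infinity]
        eventually_mono [OF eventually_nonreal, of "\<lambda>z. z * (cinner u u + z * q z) = z * (of_real s0 + z * n z)"]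
      by (simp add: nq s0)
    \<comment> \<open>The prefactor \<open>1 / s0\<close> turns the three terms of
      \<open>cinner_resolvent_Ahat\<close> into those of the Schur transform.\<close>
    have c: "(1 / of_real (norm u)) * cnj (1 / of_real (norm u)) = (1 / of_real s0 :: complex)"
      by (simp add: norm_u [symmetric] power2_eq_square)
    have "?nh z = cinner (the (resolvent Ahat z ((1 / of_real (norm u)) *\<^sub>C orth_proj K u')))
        ((1 / of_real (norm u)) *\<^sub>C orth_proj K u')" if "z \<notin> \<real>" for z
      unfolding cinner_resolvent_Ahat [OF Au that] c s0 s1 Schur_transform_def nq [OF that]
      using \<open>s0 \<noteq> 0\<close> by (simp add: field_simps power2_eq_square)
    with dom Au show ?thesis by simp
  qed
  have uhat: "(1 / of_real (norm u)) *\<^sub>C orth_proj K (the (A u)) \<in> K"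
    using P_in_K [of "the (A u)"] by (simp add: mem_K cinner_simps)
  have part4: "\<exists>t::real. (\<lambda>z. ?nh z - (- of_real t / z)) \<in> o[imag_infinity](\<lambda>z. 1 / z)"
    if "(\<lambda>z. n z - (- of_real s0 / z - of_real s1 / z ^ 2 - of_real s2 / z ^ 3))
      \<in> o[imag_infinity](\<lambda>z. 1 / z ^ 3)" for s2 :: real
  proof -
    \<comment> \<open>Multiplying the third-order expansion by \<open>z ^ 3\<close> gives the limit
      \<open>- s2\<close> required by \<open>Schur_transform_moment0\<close>.\<close>
    have "((\<lambda>z. z ^ 3 * (n z - (- of_real s0 / z - of_real s1 / z ^ 2 - of_real s2 / z ^ 3))) \<longlongrightarrow> 0) imag_infinity"
      using that unfolding smallo_inverse_power_iff .
    also have "?this \<longleftrightarrow>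
        ((\<lambda>z. (z\<^sup>2 * (of_real s0 + z * n z) + of_real s1 * z) - (- of_real s2)) \<longlongrightarrow> 0) imag_infinity"
      by (rule tendsto_cong, use eventually_nonreal in eventually_elim)
         (auto simp: field_simps power2_eq_square power3_eq_cube)
    finally have "((\<lambda>z. z\<^sup>2 * (of_real s0 + z * n z) + of_real s1 * z) \<longlongrightarrow> - of_real s2) imag_infinity"
      by (simp only: Lim_null [symmetric])
    from Schur_transform_moment0 [OF \<open>s0 \<noteq> 0\<close> n_nz m0 m1 this] show ?thesis
      unfolding tendsto_moment0_iff by blast
  qed
  show ?thesis
    unfolding Let_def
    using self_adjoint_Ahat part3 uhat part4
      Schur_transform_resolvent_representation [OF self_adjoint_vector_axioms s0 \<open>s0 \<noteq> 0\<close> assms(7)]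
    by blast
qed

end
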